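(* Let $1\le k\le M$ and $x>0$. Let $X_{i^*}$ be the $k$-th largest among $X_1,\dots,X_M$ (SNR-based selection, SBS). Then the outage probability $\Pi^{(k)}_{\rm SBS}(x)=\mathbb P\{X_{i^*}\le x\}$ is $$\Pi^{(k)}_{\rm SBS}(x)=I_{F_{X_i}(x)}(M-k+1,k),$$ where $I_\psi(p,q)=\frac{1}{B(p,q)}\int_0^\psi t^{p-1}(1-t)^{q-1}\,dt$ is the normalized incomplete beta function and $$F_{X_i}(x)=1-2\sqrt{\frac{\sigma_n^2c^2t_2x}{P_tt_1(ac-b)}}\;\exp\left(-\frac{\sigma_n^2ct_2x}{t_1(ac-b)}\right)K_1\left(2\sqrt{\frac{\sigma_n^2c^2t_2x}{P_tt_1(ac-b)}}\right)$$ is the CDF of $X_i$.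
   Context: There are $M\ge 1$ devices. The channel gains $|g_1|^2,\dots,|g_M|^2,|h_1|^2,\dots,|h_M|^2$ are independent exponential random variables with mean $1$. Parameters: $P_t>0$, $\sigma_n^2>0$, $0<t_1<1$, $t_2=1-t_1$, and real constants $a,b,c$ with $c>0$ and $ac-b>0$. The energy harvested by device $i$ is $E_i=t_1\left(\frac{aP_t|g_i|^2+b}{P_t|g_i|^2+c}-\frac bc\right)$, and the SNR of device $i$ is $X_i=\frac{|h_i|^2}{t_2\sigma_n^2}E_i$. The outage probability at rate threshold $Q>0$ is $\mathbb P\{t_2\log_2(1+X)\le Q\}=\mathbb P\{X\le x\}$ with $x=2^{Q/t_2}-1$. $B$ is the beta function and $K_1$ is the modified Bessel function of the second kind of order one. *)

theory Defs
  imports "HOL-Probability.Probability"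
begin

definition harvested_energy :: "real \<Rightarrow> real \<Rightarrow> real \<Rightarrow> real \<Rightarrow> real \<Rightarrow> real \<Rightarrow> real" where
  "harvested_energy a b c t1 Pt g = t1 * ((a * Pt * g + b) / (Pt * g + c) - b / c)"

text \<open>The arguments \<open>g\<close> and \<open>h\<close> are squared moduli of channel coefficients, and \<open>s2\<close> is the noise variance
  \<open>\<sigma>\<^sub>n\<^sup>2\<close> itself, not its square root.\<close>

definition snr :: "real \<Rightarrow> real \<Rightarrow> real \<Rightarrow> real \<Rightarrow> real \<Rightarrow> real \<Rightarrow> real \<Rightarrow> real \<Rightarrow> real \<Rightarrow> real" where
  "snr a b c t1 t2 Pt s2 g h = h / (t2 * s2) * harvested_energy a b c t1 Pt g"

text \<open>Ranks count from 1 and with multiplicity: \<open>kth_largest 1 xs\<close> is the maximum of \<open>xs\<close>,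
  \<open>kth_largest (length xs) xs\<close> the minimum.\<close>

definition kth_largest :: "nat \<Rightarrow> real list \<Rightarrow> real" where
  "kth_largest k xs = rev (sort xs) ! (k - 1)"

definition outage_prob :: "'a measure \<Rightarrow> ('a \<Rightarrow> real) \<Rightarrow> real \<Rightarrow> real" where
  "outage_prob P Y x = measure P {\<omega> \<in> space P. Y \<omega> \<le> x}"

definition norm_incomplete_beta :: "real \<Rightarrow> real \<Rightarrow> real \<Rightarrow> real" where
  "norm_incomplete_beta \<psi> p q =
     1 / Beta p q * (LBINT t:{0..\<psi>}. t powr (p - 1) * (1 - t) powr (q - 1))"

text \<open>Modified Bessel function of the second kind of real order \<open>\<nu>\<close>, for \<open>z > 0\<close>, by its classical
  integral representation.\<close>

definition bessel_K :: "real \<Rightarrow> real \<Rightarrow> real" where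
  "bessel_K \<nu> z = (LBINT t:{0..}. exp (- z * cosh t) * cosh (\<nu> * t))"

definition snr_cdf :: "real \<Rightarrow> real \<Rightarrow> real \<Rightarrow> real \<Rightarrow> real \<Rightarrow> real \<Rightarrow> real \<Rightarrow> real \<Rightarrow> real" where
  "snr_cdf a b c t1 t2 Pt s2 x =
     1 - 2 * sqrt (s2 * c\<^sup>2 * t2 * x / (Pt * t1 * (a * c - b)))
           * exp (- (s2 * c * t2 * x / (t1 * (a * c - b))))
           * bessel_K 1 (2 * sqrt (s2 * c\<^sup>2 * t2 * x / (Pt * t1 * (a * c - b))))"

end

theory Submission
  imports Defs
begin

text \<open>
  For \<open>g > 0\<close> the event \<open>x < X\<^sub>i\<close> reads \<open>A + B / g < h\<close> with positive constants \<open>A\<close> and \<open>B\<close>, so its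
  probability is \<open>exp (- A)\<close> times the integral of \<open>exp (- g - B / g)\<close> over \<open>g > 0\<close>; substituting
  \<open>g = sqrt B * exp t\<close> and folding the line at \<open>t = 0\<close> turns the latter into the integral representation
  of \<open>K\<^sub>1\<close>. The \<open>k\<close>-th largest SNR is at most \<open>x\<close> iff at least \<open>M - k + 1\<close> of the independent events
  \<open>X\<^sub>i \<le> x\<close> occur, which gives a binomial tail, that is a sum of Bernstein polynomials in \<open>F(x)\<close>. Its
  derivative in \<open>F(x)\<close> telescopes to the integrand of the incomplete beta function.
\<close>

section \<open>Order statistics of finite lists\<close>

lemma sorted_nth_le_iff:
  fixes x :: "'a::linorder"
  assumes "sorted ys" "j < length ys"
  shows "ys ! j \<le> x \<longleftrightarrow> j < length (filter (\<lambda>y. y \<le> x) ys)"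
  using assms
proof (induction ys arbitrary: j)
  case (Cons y ys)
  show ?case
  proof (cases "y \<le> x")
    case True
    with Cons show ?thesis by (cases j) auto
  next
    case False
    with Cons.prems have "\<forall>z\<in>set (y # ys). \<not> z \<le> x" by auto
    moreover from this have "\<not> (y # ys) ! j \<le> x"
      using Cons.prems nth_mem by blast
    ultimately show ?thesis by (simp add: filter_False)
  qed
qed simp

text \<open>Reversal turns rank \<open>k\<close>, counted from 1, into index
  \<open>length xs - k\<close> of the ascending list, where the entries at most \<open>x\<close>
  form an initial segment. Sorting preserves the number of such entries, repetitions
  included.\<close>

lemma kth_largest_le_iff:
  assumes "1 \<le> k" "k \<le> length xs"
  shows "kth_largest k xs \<le> x \<longleftrightarrow> length xs - k < length (filter (\<lambda>y. y \<le> x) xs)"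
proof -
  have "kth_largest k xs = sort xs ! (length xs - k)"
    using assms by (simp add: kth_largest_def rev_nth)
  moreover have "length (filter (\<lambda>y. y \<le> x) (sort xs)) = length (filter (\<lambda>y. y \<le> x) xs)"
    by (metis mset_filter mset_sort size_mset)
  ultimately show ?thesis
    using sorted_nth_le_iff[of "sort xs" "length xs - k" x] assms by simp
qed

section \<open>Bernstein tails and the incomplete beta function\<close>

lemma DERIV_Bernstein:
  assumes "j \<le> n"
  shows "(Bernstein n j has_real_derivative
     (real j * real (n choose j) * t ^ (j - 1) * (1 - t) ^ (n - j)
      - real (Suc j) * real (n choose Suc j) * t ^ j * (1 - t) ^ (n - Suc j))) (at t)"
proof -
  \<comment> \<open>The product rule yields the coefficient \<open>(n - j) * (n choose j)\<close> in
    its negative term. This rewriting makes that term the positive term for \<open>Suc j\<close>,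
    which prepares the telescoping.\<close>
  have "real (Suc j) * real (n choose Suc j) = real (n - j) * real (n choose j)"
    by (metis binomial_absorb_comp of_nat_mult binomial_absorption mult.commute)
  then show ?thesis
    unfolding Bernstein_def[abs_def]
    by (auto intro!: derivative_eq_intros simp: algebra_simps)
qed

lemma DERIV_Bernstein_tail:
  assumes "m \<le> n"
  shows "((\<lambda>t. \<Sum>j=m..n. Bernstein n j t) has_real_derivative
     real m * real (n choose m) * t ^ (m - 1) * (1 - t) ^ (n - m)) (at t)"
proof -
  define T where "T j = real j * real (n choose j) * t ^ (j - 1) * (1 - t) ^ (n - j)" for j
  have "((\<lambda>t. \<Sum>j=m..n. Bernstein n j t) has_real_derivative (\<Sum>j=m..n. T j - T (Suc j))) (at t)"
    unfolding T_def using DERIV_Bernstein by (intro DERIV_sum) simp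
  \<comment> \<open>The upper boundary term \<open>T (Suc n)\<close> vanishes because
    \<open>n choose Suc n\<close> is zero.\<close>
  also have "(\<Sum>j=m..n. T j - T (Suc j)) = T m"
    using sum_Suc_diff[of m "n" "\<lambda>j. - T j"] assms by (simp add: T_def)
  finally show ?thesis by (simp add: T_def)
qed

text \<open>The fundamental theorem of calculus applies: the tail has the beta integrand as
  derivative, up to a constant that equals the reciprocal beta value, and it vanishes at 0 because
  every index is at least \<open>m\<close>, hence at least 1.\<close>

lemma norm_incomplete_beta_eq_Bernstein_tail:
  assumes "1 \<le> m" "m \<le> n" "0 \<le> \<psi>" "\<psi> \<le> 1"
  shows "norm_incomplete_beta \<psi> (real m) (real n - real m + 1) = (\<Sum>j=m..n. Bernstein n j \<psi>)"
proof -
  let ?f = "\<lambda>t::real. t ^ (m - 1) * (1 - t) ^ (n - m)"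
  define C where "C = real m * real (n choose m)"
  have C: "C = 1 / Beta (real m) (real n - real m + 1)"
  proof -
    have "Gamma (real m) = Gamma (1 + real (m - 1))"
      using assms by (intro arg_cong[where f = Gamma]) simp
    also have "\<dots> = fact (m - 1)" by (rule Gamma_fact)
    finally have 1: "Gamma (real m) = fact (m - 1)" .
    have "Gamma (real n - real m + 1) = Gamma (1 + real (n - m))"
      using assms by (intro arg_cong[where f = Gamma]) simp
    also have "\<dots> = fact (n - m)" by (rule Gamma_fact)
    finally have 2: "Gamma (real n - real m + 1) = fact (n - m)" .
    have 3: "Gamma (real n + 1) = fact n"
      using Gamma_fact[of n, where 'a = real] by (simp add: add.commute)
    have "fact m = real m * fact (m - 1)" using assms by (intro fact_reduce) simp
    then have "C = fact n / (fact (m - 1) * fact (n - m))"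
      using assms by (simp add: C_def binomial_fact)
    then show ?thesis using 1 2 3 by (simp add: Beta_def)
  qed
  have "C * (LBINT t:{0..\<psi>}. t powr (real m - 1) * (1 - t) powr (real n - real m + 1 - 1))
     = C * (LBINT t:{0..\<psi>}. ?f t)"
  proof (rule arg_cong[where f = "(*) C"], unfold set_lebesgue_integral_def, rule integral_cong_AE)
    \<comment> \<open>Since \<open>0 powr 0 = 0\<close>, the integrands may differ at \<open>0\<close> and \<open>1\<close>.\<close>
    have "AE t in lborel. t \<noteq> (0::real)" "AE t in lborel. t \<noteq> (1::real)"
      by (rule AE_lborel_singleton)+
    then show "AE t in lborel. indicat_real {0..\<psi>} t *\<^sub>R (t powr (real m - 1) * (1 - t) powr (real n - real m + 1 - 1))
       = indicat_real {0..\<psi>} t *\<^sub>R ?f t"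
    proof eventually_elim
      case (elim t)
      show ?case
      proof (cases "t \<in> {0..\<psi>}")
        case True
        with elim assms have "0 < t" "0 < 1 - t" by auto
        moreover have "real m - 1 = real (m - 1)" "real n - real m + 1 - 1 = real (n - m)"
          using assms by auto
        ultimately show ?thesis by (simp only: powr_realpow)
      qed simp
    qed
  qed auto
  also have "\<dots> = (LBINT t:{0..\<psi>}. C * ?f t)" by simp
  also have "\<dots> = (\<Sum>j=m..n. Bernstein n j \<psi>) - (\<Sum>j=m..n. Bernstein n j 0)"
    unfolding set_lebesgue_integral_def
  proof (rule integral_FTC_atLeastAtMost)
    fix t assume "0 \<le> t" "t \<le> \<psi>"
    show "((\<lambda>t. \<Sum>j=m..n. Bernstein n j t) has_vector_derivative C * ?f t) (at t within {0..\<psi>})"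
      using has_field_derivative_at_within[OF DERIV_Bernstein_tail[OF assms(2), of t]]
      by (simp add: C_def has_real_derivative_iff_has_vector_derivative[symmetric] mult.assoc)
  qed (use assms in \<open>auto intro!: continuous_intros\<close>)
  also have "(\<Sum>j=m..n. Bernstein n j 0) = 0"
    using assms by (intro sum.neutral) (auto simp: Bernstein_def)
  finally show ?thesis by (simp add: norm_incomplete_beta_def C)
qed

section \<open>Counting independent events of equal probability\<close>

context prob_space begin

text \<open>Prescribing the exact set of hits asks each index in \<open>J\<close> for a hit and each
  other index for a miss, so independence factors the probability.\<close>

lemma prob_indep_vars_hit_set:
  assumes indep: "indep_vars (\<lambda>_. N) X I" and fin: "finite I" and B: "B \<in> sets N"
    and p: "\<And>i. i \<in> I \<Longrightarrow> prob {\<omega> \<in> space M. X i \<omega> \<in> B} = p" and J: "J \<subseteq> I"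
  shows "prob {\<omega> \<in> space M. {i \<in> I. X i \<omega> \<in> B} = J} = p ^ card J * (1 - p) ^ (card I - card J)"
\<comment> \<open>The empty index set is treated apart: an intersection over it is the whole type
  rather than the sample space.\<close>
proof (cases "I = {}")
  case True
  then show ?thesis using J prob_space by simp
next
  case False
  define A where "A i = (if i \<in> J then B else space N - B)" for i
  have rv: "X i \<in> measurable M N" if "i \<in> I" for i
    using indep that by (simp add: indep_vars_def)
  have ev: "{\<omega> \<in> space M. X i \<omega> \<in> B} \<in> events" if "i \<in> I" for i
    using measurable_sets[OF rv[OF that] B] by (simp add: vimage_def Int_def conj_commute)
  have pA: "prob (X i -` A i \<inter> space M) = (if i \<in> J then p else 1 - p)" if "i \<in> I" for i
  proof (cases "i \<in> J")
    case True
    then show ?thesis using p[OF that] by (simp add: A_def vimage_def Int_def conj_commute)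
  next
    case False
    then have "X i -` A i \<inter> space M = space M - {\<omega> \<in> space M. X i \<omega> \<in> B}"
      using measurable_space[OF rv[OF that]] by (auto simp: A_def)
    then show ?thesis using p[OF that] prob_compl[OF ev[OF that]] False by simp
  qed
  have "{\<omega> \<in> space M. {i \<in> I. X i \<omega> \<in> B} = J} = (\<Inter>i\<in>I. X i -` A i \<inter> space M)"
    using False J measurable_space[OF rv] by (auto simp: A_def split: if_splits)
  also have "prob \<dots> = (\<Prod>i\<in>I. prob (X i -` A i \<inter> space M))"
    using B False fin by (intro indep_varsD_finite[OF indep]) (auto simp: A_def)
  also have "\<dots> = (\<Prod>i\<in>I. if i \<in> J then p else 1 - p)"
    by (intro prod.cong) (auto simp: pA)
  also have "\<dots> = (\<Prod>i\<in>J. p) * (\<Prod>i\<in>I - J. 1 - p)"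
    using fin J by (simp add: prod.If_cases Int_absorb1 Diff_eq)
  finally show ?thesis
    using fin J by (simp add: card_Diff_subset finite_subset)
qed

text \<open>The event splits disjointly according to the set of hits. Sets of equal cardinality
  \<open>j\<close> are equally likely, and there are \<open>card I choose j\<close> of them.\<close>

lemma prob_indep_vars_count_ge:
  assumes indep: "indep_vars (\<lambda>_. N) X I" and fin: "finite I" and B: "B \<in> sets N"
    and p: "\<And>i. i \<in> I \<Longrightarrow> prob {\<omega> \<in> space M. X i \<omega> \<in> B} = p"
  shows "prob {\<omega> \<in> space M. m \<le> card {i \<in> I. X i \<omega> \<in> B}} = (\<Sum>j=m..card I. Bernstein (card I) j p)"
proof -
  define S where "S = {J. J \<subseteq> I \<and> m \<le> card J}"
  have rv: "X i \<in> measurable M N" if "i \<in> I" for i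
    using indep that by (simp add: indep_vars_def)
  have finS: "finite S" using fin by (auto simp: S_def)
  have ev: "{\<omega> \<in> space M. {i \<in> I. X i \<omega> \<in> B} = J} \<in> events" if "J \<subseteq> I" for J
  proof -
    \<comment> \<open>One condition per index turns the event into a finite conjunction of
      measurable ones.\<close>
    have "{\<omega> \<in> space M. {i \<in> I. X i \<omega> \<in> B} = J} = {\<omega> \<in> space M. \<forall>i\<in>I. (X i \<omega> \<in> B) = (i \<in> J)}"
      using that by auto
    also have "\<dots> \<in> events"
    proof (rule sets.sets_Collect_finite_All[OF _ fin])
      fix i assume "i \<in> I"
      then have "{\<omega> \<in> space M. X i \<omega> \<in> B} \<in> events"
        using measurable_sets[OF rv B, of i] by (simp add: vimage_def Int_def conj_commute)
      then show "{\<omega> \<in> space M. (X i \<omega> \<in> B) = (i \<in> J)} \<in> events"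
        by (cases "i \<in> J") (auto dest: sets.sets_Collect_neg)
    qed
    finally show ?thesis .
  qed
  have "{\<omega> \<in> space M. m \<le> card {i \<in> I. X i \<omega> \<in> B}}
      = (\<Union>J\<in>S. {\<omega> \<in> space M. {i \<in> I. X i \<omega> \<in> B} = J})"
    by (auto simp: S_def)
  also have "prob \<dots> = (\<Sum>J\<in>S. prob {\<omega> \<in> space M. {i \<in> I. X i \<omega> \<in> B} = J})"
    using finS ev by (intro finite_measure_finite_Union) (auto simp: S_def disjoint_family_on_def)
  also have "\<dots> = (\<Sum>J\<in>S. p ^ card J * (1 - p) ^ (card I - card J))"
    by (intro sum.cong prob_indep_vars_hit_set[OF indep fin B p]) (auto simp: S_def)
  also have "\<dots> = (\<Sum>j=m..card I. \<Sum>J\<in>{J\<in>S. card J = j}. p ^ card J * (1 - p) ^ (card I - card J))"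
    using finS fin by (intro sum.group[symmetric]) (auto simp: S_def card_mono)
  also have "\<dots> = (\<Sum>j=m..card I. Bernstein (card I) j p)"
  proof (intro sum.cong refl)
    fix j assume "j \<in> {m..card I}"
    then have "{J\<in>S. card J = j} = {J. J \<subseteq> I \<and> card J = j}" by (auto simp: S_def)
    then show "(\<Sum>J\<in>{J\<in>S. card J = j}. p ^ card J * (1 - p) ^ (card I - card J)) = Bernstein (card I) j p"
      using n_subsets[OF fin, of j] by (simp add: Bernstein_def)
  qed
  finally show ?thesis .
qed

end

section \<open>An exponential integral as a Bessel function\<close>

lemma exp_minus_add_inverse_absolutely_integrable:
  fixes B :: real
  assumes "0 < B"
  shows "(\<lambda>g::real. exp (- g - B / g)) absolutely_integrable_on {0<..}"
proof -
  have "set_integrable lborel {0<..} (\<lambda>g. exp (- g - B / g))"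
    unfolding set_integrable_def
  \<comment> \<open>For \<open>g > 0\<close> the term \<open>B / g\<close> is positive, so the
    standard exponential density dominates; it is integrable because its total mass is one.\<close>
  proof (rule Bochner_Integration.integrable_bound)
    have "(\<integral>\<^sup>+g. ennreal (exponential_density 1 g) \<partial>lborel) = 1"
      using prob_space.emeasure_space_1[OF prob_space_exponential_density[of 1]]
      by (simp add: emeasure_density)
    then show "integrable lborel (exponential_density 1)"
      by (intro integrableI_nonneg) (auto simp: exponential_density_nonneg)
    show "AE g in lborel. norm (indicator {0<..} g *\<^sub>R exp (- g - B / g)) \<le> norm (exponential_density 1 g)"
      using assms by (auto simp: exponential_density_def indicator_def)
  qed auto
  then show ?thesis
    by (simp add: set_integrable_def integrable_completion)
qed

lemma exp_add_inverse_integral_bessel_K: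
  fixes B :: real
  assumes "0 < B"
  shows "(LBINT g:{0<..}. exp (- g - B / g)) = 2 * sqrt B * bessel_K 1 (2 * sqrt B)"
proof -
  define s where "s = sqrt B"
  have s: "0 < s" "s * s = B" using assms by (auto simp: s_def)
  let ?f = "\<lambda>g::real. exp (- g - B / g)"
  define F where "F t = exp (- (2 * s) * cosh t) * exp t" for t :: real
  have img: "(\<lambda>t. s * exp t) ` UNIV = {0<..}"
  proof (intro equalityI subsetI)
    fix g :: real assume "g \<in> {0<..}"
    then have "g = s * exp (ln (g / s))" using s by simp
    then show "g \<in> (\<lambda>t. s * exp t) ` UNIV" by blast
  qed (use s in auto)
  have "inj (\<lambda>t. s * exp t)" using s by (auto simp: inj_on_def)
  moreover have "((\<lambda>t. s * exp t) has_real_derivative s * exp t) (at t)" for t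
    by (auto intro!: derivative_eq_intros)
  \<comment> \<open>The scale \<open>s = sqrt B\<close> makes the exponent symmetric: at
    \<open>g = s * exp t\<close> the term \<open>B / g\<close> is \<open>s * exp (- t)\<close>, and
    the two add up to \<open>2 * s * cosh t\<close>. The Jacobian contributes
    \<open>s * exp t\<close>.\<close>
  moreover have "\<bar>s * exp t\<bar> * ?f (s * exp t) = s * F t" for t
  proof -
    have "B / (s * exp t) = s * exp (- t)"
      using s by (simp add: exp_minus field_simps)
    then have "- (s * exp t) - B / (s * exp t) = - (2 * s) * cosh t"
      by (simp add: cosh_def algebra_simps)
    then show ?thesis using s by (simp add: F_def)
  qed
  \<comment> \<open>Besides the equality of integrals, the change of variables transfers
    integrability to \<open>F\<close>, which the splitting of the line below relies on.\<close>
  ultimately have "(\<lambda>t. s * F t) absolutely_integrable_on UNIV \<and> integral UNIV (\<lambda>t. s * F t) = integral {0<..} ?f"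
    using has_absolute_integral_change_of_variables_1'[of UNIV "\<lambda>t. s * exp t" "\<lambda>t. s * exp t" ?f
        "integral {0<..} ?f"] exp_minus_add_inverse_absolutely_integrable[OF assms]
    by (simp add: img)
  then have "integrable lebesgue (\<lambda>t. s * F t)" and I: "s * integral UNIV F = integral {0<..} ?f"
    by (auto simp: set_integrable_def)
  then have "integrable lebesgue F" using s by simp
  moreover have [measurable]: "F \<in> borel_measurable borel"
    unfolding F_def by (intro borel_measurable_continuous_onI continuous_intros)
  ultimately have intF: "integrable lborel F" by (simp add: integrable_completion)
  have set_int: "set_integrable lborel S f"
    if "integrable lborel f" "S \<in> sets borel" for S and f :: "real \<Rightarrow> real"
    unfolding set_integrable_def using that by (intro integrable_mult_indicator) auto
  have "(LBINT g:{0<..}. ?f g) = integral {0<..} ?f"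
    using exp_minus_add_inverse_absolutely_integrable[OF assms]
    by (intro set_borel_integral_eq_integral) (simp add: set_integrable_def integrable_completion)
  also have "\<dots> = s * (LBINT t. F t)"
    using I integral_lborel[OF intF] by simp
  also have "(LBINT t. F t) = (LBINT t:{0..}. F t) + (LBINT t:{..<0}. F t)"
  proof -
    have "(LBINT t:{0..} \<union> {..<0}. F t) = (LBINT t:{0..}. F t) + (LBINT t:{..<0}. F t)"
      using intF by (intro set_integral_Un set_int) auto
    moreover have "{0..} \<union> {..<0} = (UNIV :: real set)" by auto
    ultimately show ?thesis by (simp add: set_lebesgue_integral_def)
  qed
  also have "(LBINT t:{..<0}. F t) = (LBINT t:{0<..}. F (- t))"
    by (subst set_integral_reflect) (auto intro!: arg_cong2[where f = "\<lambda>A f. set_lebesgue_integral lborel A f"])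
  \<comment> \<open>Adding the null set \<open>{0}\<close> gives both halves the same
    domain.\<close>
  also have "\<dots> = (LBINT t:{0..}. F (- t))"
    unfolding set_lebesgue_integral_def
    by (intro integral_cong_AE) (use AE_lborel_singleton[of "0::real"] in \<open>auto simp: indicator_def elim!: eventually_mono\<close>)
  also have "(LBINT t:{0..}. F t) + (LBINT t:{0..}. F (- t)) = (LBINT t:{0..}. F t + F (- t))"
  proof (rule set_integral_add(2)[symmetric])
    have "integrable lborel (\<lambda>t. F (- t))"
      using lborel_integrable_real_affine[OF intF, of "-1" 0] by simp
    with intF show "set_integrable lborel {0..} F" "set_integrable lborel {0..} (\<lambda>t. F (- t))"
      by (auto intro: set_int)
  qed
  \<comment> \<open>As \<open>cosh\<close> is even, \<open>F t\<close> and \<open>F (- t)\<close>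
    share their first factor, and \<open>exp t + exp (- t)\<close> is \<open>2 * cosh t\<close>. The
    form \<open>1 * t\<close> displays the order 1 of the Bessel function.\<close>
  also have "\<dots> = (LBINT t:{0..}. 2 * (exp (- (2 * s) * cosh t) * cosh (1 * t)))"
    by (simp add: F_def cosh_def algebra_simps)
  also have "\<dots> = 2 * bessel_K 1 (2 * s)"
    by (simp add: bessel_K_def)
  finally show ?thesis by (simp add: s_def)
qed

section \<open>Distribution of a single SNR\<close>

lemma harvested_energy_eq:
  assumes "c > 0" "Pt > 0" "0 < g"
  shows "harvested_energy a b c t1 Pt g = t1 * (a * c - b) * Pt * g / (c * (Pt * g + c))"
proof -
  have "Pt * g + c > 0" using assms by (simp add: add_pos_pos)
  then show ?thesis using assms by (simp add: harvested_energy_def field_simps)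
qed

text \<open>For fixed \<open>g > 0\<close> the SNR is linear in \<open>h\<close> with a positive
  slope \<open>q\<close>, so the condition is \<open>x / q < h\<close>. The factor
  \<open>Pt * g + c\<close> in the denominator of \<open>q\<close> splits \<open>x / q\<close> into
  a constant and a multiple of \<open>1 / g\<close>.\<close>

lemma less_snr_iff:
  fixes a b c t1 t2 Pt s2 x g h :: real
  assumes "Pt > 0" "s2 > 0" "0 < t1" "0 < t2" "c > 0" "a * c - b > 0" "0 < g"
  shows "x < snr a b c t1 t2 Pt s2 g h \<longleftrightarrow>
    s2 * c * t2 * x / (t1 * (a * c - b)) + s2 * c\<^sup>2 * t2 * x / (Pt * t1 * (a * c - b)) / g < h"
proof -
  define d where "d = a * c - b"
  define q where "q = t1 * d * Pt * g / (c * (Pt * g + c) * t2 * s2)"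
  have d: "d > 0" using assms by (simp add: d_def)
  have P: "Pt * g + c > 0" using assms by (simp add: add_pos_pos)
  have q: "q > 0" using assms d P by (simp add: q_def)
  have "snr a b c t1 t2 Pt s2 g h = h * q"
    using assms P by (simp add: snr_def harvested_energy_eq q_def d_def)
  moreover have "s2 * c * t2 * x / (t1 * d) + s2 * c\<^sup>2 * t2 * x / (Pt * t1 * d) / g = x / q"
    using assms d P by (simp add: q_def divide_simps power2_eq_square) (simp add: algebra_simps)
  ultimately show ?thesis
    using q by (simp add: d_def pos_divide_less_eq)
qed

text \<open>By Fubini, the exponential tail of \<open>H\<close> beyond \<open>A + B / g\<close> is
  integrated against the density of \<open>G\<close>.\<close>

lemma (in prob_space) prob_add_divide_less_exponential:
  fixes G H :: "'a \<Rightarrow> real"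
  assumes indep: "indep_var borel G borel H"
    and G: "distributed M lborel G (exponential_density 1)"
    and H: "distributed M lborel H (exponential_density 1)"
    and A: "0 \<le> A" and B: "0 < B"
  shows "prob {\<omega> \<in> space M. 0 < G \<omega> \<and> A + B / G \<omega> < H \<omega>}
    = 2 * sqrt B * exp (- A) * bessel_K 1 (2 * sqrt B)"
proof -
  have [measurable]: "random_variable borel G" "random_variable borel H"
    using indep by (auto simp: indep_var_distribution_eq)
  interpret H: prob_space "distr M borel H" by (rule prob_space_distr) simp
  define S where "S = {z :: real \<times> real. 0 < fst z \<and> A + B / fst z < snd z}"
  have S[measurable]: "S \<in> sets (borel \<Otimes>\<^sub>M borel)"
  proof -
    have "{z \<in> space (borel \<Otimes>\<^sub>M borel). 0 < fst z \<and> A + B / fst z < snd z} \<in> sets (borel \<Otimes>\<^sub>M borel)"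
      by measurable
    then show ?thesis by (simp add: S_def space_pair_measure)
  qed
  have Hgt: "emeasure (distr M borel H) {y<..} = ennreal (exp (- y))" if "0 \<le> y" for y
    using exponential_distributedD_gt[OF H that]
    by (simp add: emeasure_distr emeasure_eq_measure vimage_def Int_def conj_commute)
  \<comment> \<open>For \<open>g > 0\<close> the section is a half-line starting at a nonnegative
    point, where the tail formula for \<open>H\<close> is valid; otherwise it is empty.\<close>
  have sect: "ennreal (exponential_density 1 g) * emeasure (distr M borel H) (Pair g -` S)
      = ennreal (exp (- A) * (indicator {0<..} g * exp (- g - B / g)))" for g
  proof (cases "0 < g")
    case True
    then have "Pair g -` S = {A + B / g<..}" by (auto simp: S_def)
    moreover have "0 \<le> A + B / g" using True A B by simp
    ultimately show ?thesis
      using True by (simp add: Hgt exponential_density_def ennreal_mult[symmetric] mult_exp_exp algebra_simps)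
  next
    case False
    then show ?thesis by (simp add: S_def)
  qed
  have intf: "set_integrable lborel {0<..} (\<lambda>g. exp (- g - B / g))"
    using exp_minus_add_inverse_absolutely_integrable[OF B]
    by (simp add: set_integrable_def integrable_completion)
  have "ennreal (prob {\<omega> \<in> space M. 0 < G \<omega> \<and> A + B / G \<omega> < H \<omega>})
      = emeasure (distr M (borel \<Otimes>\<^sub>M borel) (\<lambda>\<omega>. (G \<omega>, H \<omega>))) S"
    using S by (subst emeasure_distr)
      (auto simp: S_def emeasure_eq_measure vimage_def Int_def conj_commute conj_left_commute)
  also have "\<dots> = emeasure (distr M borel G \<Otimes>\<^sub>M distr M borel H) S"
    using indep by (simp add: indep_var_distribution_eq)
  also have "\<dots> = (\<integral>\<^sup>+g. emeasure (distr M borel H) (Pair g -` S) \<partial>distr M borel G)"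
    by (rule H.emeasure_pair_measure_alt) (simp add: S)
  also have "distr M borel G = density lborel (exponential_density 1)"
    using distributed_distr_eq_density[OF G] by (metis distr_cong sets_lborel)
  also have "(\<integral>\<^sup>+g. emeasure (distr M borel H) (Pair g -` S) \<partial>density lborel (exponential_density 1))
      = (\<integral>\<^sup>+g. ennreal (exponential_density 1 g) * emeasure (distr M borel H) (Pair g -` S) \<partial>lborel)"
    using H.measurable_emeasure_Pair[of S borel] S by (intro nn_integral_density) auto
  also have "\<dots> = (\<integral>\<^sup>+g. ennreal (exp (- A) * (indicator {0<..} g * exp (- g - B / g))) \<partial>lborel)"
    by (simp add: sect)
  also have "\<dots> = ennreal (\<integral>g. exp (- A) * (indicator {0<..} g * exp (- g - B / g)) \<partial>lborel)"
    using intf by (intro nn_integral_eq_integral) (auto simp: set_integrable_def)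
  also have "(\<integral>g. exp (- A) * (indicator {0<..} g * exp (- g - B / g)) \<partial>lborel)
      = exp (- A) * (2 * sqrt B * bessel_K 1 (2 * sqrt B))"
    using exp_add_inverse_integral_bessel_K[OF B] by (simp add: set_lebesgue_integral_def)
  finally have *: "ennreal (prob {\<omega> \<in> space M. 0 < G \<omega> \<and> A + B / G \<omega> < H \<omega>})
      = ennreal (exp (- A) * (2 * sqrt B * bessel_K 1 (2 * sqrt B)))" .
  \<comment> \<open>Cancelling \<open>ennreal\<close> requires both sides to be nonnegative.\<close>
  have "0 \<le> bessel_K 1 (2 * sqrt B)"
    unfolding bessel_K_def set_lebesgue_integral_def
    by (intro Bochner_Integration.integral_nonneg) auto
  then show ?thesis
    using * B by (subst (asm) ennreal_inj) (auto simp: mult_ac)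
qed

lemma (in prob_space) cdf_snr_exponential:
  fixes G H :: "'a \<Rightarrow> real"
  assumes indep: "indep_var borel G borel H"
    and G: "distributed M lborel G (exponential_density 1)"
    and H: "distributed M lborel H (exponential_density 1)"
    and pos: "Pt > 0" "s2 > 0" "0 < t1" "0 < t2" "c > 0" "a * c - b > 0" "x > 0"
  shows "cdf (distr M borel (\<lambda>\<omega>. snr a b c t1 t2 Pt s2 (G \<omega>) (H \<omega>))) x
    = snr_cdf a b c t1 t2 Pt s2 x"
proof -
  let ?X = "\<lambda>\<omega>. snr a b c t1 t2 Pt s2 (G \<omega>) (H \<omega>)"
  define A where "A = s2 * c * t2 * x / (t1 * (a * c - b))"
  define B where "B = s2 * c\<^sup>2 * t2 * x / (Pt * t1 * (a * c - b))"
  have AB: "0 \<le> A" "0 < B" using pos by (simp_all add: A_def B_def)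
  have [measurable]: "random_variable borel G" "random_variable borel H"
    using indep by (auto simp: indep_var_distribution_eq)
  have X[measurable]: "random_variable borel ?X"
    unfolding snr_def harvested_energy_def by measurable
  have less_iff: "x < ?X \<omega> \<longleftrightarrow> A + B / G \<omega> < H \<omega>" if "0 < G \<omega>" for \<omega>
    unfolding A_def B_def using pos(1-6) that by (rule less_snr_iff)
  \<comment> \<open>The reformulation of \<open>x < ?X \<omega>\<close> is available only for a
    positive gain, which holds almost surely.\<close>
  have "prob {\<omega> \<in> space M. 0 < G \<omega>} = 1"
    using exponential_distributedD_gt[OF G, of 0] by simp
  then have "AE \<omega> in M. 0 < G \<omega>"
    by (subst (asm) prob_Collect_eq_1) auto
  then have "prob {\<omega> \<in> space M. x < ?X \<omega>} = prob {\<omega> \<in> space M. 0 < G \<omega> \<and> A + B / G \<omega> < H \<omega>}"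
    by (intro finite_measure_eq_AE) (auto elim!: eventually_mono simp: less_iff)
  also have "\<dots> = 2 * sqrt B * exp (- A) * bessel_K 1 (2 * sqrt B)"
    by (rule prob_add_divide_less_exponential[OF indep G H AB])
  finally have gt: "prob {\<omega> \<in> space M. x < ?X \<omega>} = 2 * sqrt B * exp (- A) * bessel_K 1 (2 * sqrt B)" .
  have "cdf (distr M borel ?X) x = prob {\<omega> \<in> space M. ?X \<omega> \<le> x}"
    unfolding cdf_def by (subst measure_distr) (auto simp: vimage_def Int_def conj_commute)
  also have "{\<omega> \<in> space M. ?X \<omega> \<le> x} = space M - {\<omega> \<in> space M. x < ?X \<omega>}"
    by auto
  also have "prob \<dots> = 1 - prob {\<omega> \<in> space M. x < ?X \<omega>}"
    by (intro prob_compl) measurable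
  finally show ?thesis
    by (simp add: gt snr_cdf_def A_def B_def)
qed

section \<open>Outage probability of the selected device\<close>

theorem theorem2:
  fixes P :: "'a measure"
    and G H X :: "nat \<Rightarrow> 'a \<Rightarrow> real"
    and istar :: "'a \<Rightarrow> nat"
    and M k :: nat
    and a b c t1 t2 Pt s2 x :: real
  assumes "prob_space P"
    and "M \<ge> 1"
    and "Pt > 0" and "s2 > 0"
    and "0 < t1" and "t1 < 1" and "t2 = 1 - t1"
    and "c > 0" and "a * c - b > 0"
    and "\<And>i. i \<in> {1..M} \<Longrightarrow> distributed P lborel (G i) (exponential_density 1)"
    and "\<And>i. i \<in> {1..M} \<Longrightarrow> distributed P lborel (H i) (exponential_density 1)"
    and "prob_space.indep_vars P (\<lambda>_. borel) (case_sum G H) ({1..M} <+> {1..M})"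
    and "\<And>i \<omega>. X i \<omega> = snr a b c t1 t2 Pt s2 (G i \<omega>) (H i \<omega>)"
    and "1 \<le> k" and "k \<le> M"
    and "\<And>\<omega>. \<omega> \<in> space P \<Longrightarrow> istar \<omega> \<in> {1..M}"
    and "\<And>\<omega>. \<omega> \<in> space P \<Longrightarrow>
           X (istar \<omega>) \<omega> = kth_largest k (map (\<lambda>i. X i \<omega>) [1..<M+1])"
    and "x > 0"
  shows "(\<forall>i\<in>{1..M}. cdf (distr P borel (X i)) x = snr_cdf a b c t1 t2 Pt s2 x) \<and>
         outage_prob P (\<lambda>\<omega>. X (istar \<omega>) \<omega>) x =
           norm_incomplete_beta (snr_cdf a b c t1 t2 Pt s2 x) (real M - real k + 1) (real k)"
proof -
  interpret prob_space P by fact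
  let ?I = "{1..M}"
  have indep: "indep_vars (\<lambda>_. borel) (case_sum G H) (?I <+> ?I)" by fact
  have t2: "0 < t2" using assms by simp
  have X_eq: "X = (\<lambda>i \<omega>. snr a b c t1 t2 Pt s2 (G i \<omega>) (H i \<omega>))"
    using assms(13) by (intro ext)
  define p where "p = snr_cdf a b c t1 t2 Pt s2 x"

  have indep_GH: "indep_var borel (G i) borel (H i)" if "i \<in> ?I" for i
  proof -
    \<comment> \<open>\<open>G i\<close> and \<open>H i\<close> are read off the restrictions of the
      joint family to the disjoint index sets \<open>{Inl i}\<close> and
      \<open>{Inr i}\<close>.\<close>
    have "indep_var borel ((\<lambda>f. f (Inl i)) \<circ> (\<lambda>\<omega>. restrict (\<lambda>j. case_sum G H j \<omega>) {Inl i}))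
        borel ((\<lambda>f. f (Inr i)) \<circ> (\<lambda>\<omega>. restrict (\<lambda>j. case_sum G H j \<omega>) {Inr i}))"
      using that by (intro indep_var_compose[OF indep_var_restrict[OF indep]]) auto
    then show ?thesis by (simp add: comp_def)
  qed
  have indep_X: "indep_vars (\<lambda>_. borel) X ?I"
  proof -
    \<comment> \<open>The blocks \<open>{Inl i, Inr i}\<close> are pairwise disjoint, and each SNR
      is a measurable function of its own block.\<close>
    have "indep_vars (\<lambda>i. PiM {Inl i, Inr i} (\<lambda>_. borel))
        (\<lambda>i \<omega>. restrict (\<lambda>j. case_sum G H j \<omega>) {Inl i, Inr i}) ?I"
      using indep by (rule indep_vars_restrict) (auto simp: disjoint_family_on_def)
    then have "indep_vars (\<lambda>_. borel) (\<lambda>i \<omega>.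
        (\<lambda>f. snr a b c t1 t2 Pt s2 (f (Inl i)) (f (Inr i)))
          (restrict (\<lambda>j. case_sum G H j \<omega>) {Inl i, Inr i})) ?I"
      by (rule indep_vars_compose2) (unfold snr_def harvested_energy_def, measurable)
    then show ?thesis by (simp add: X_eq)
  qed

  have cdf_X: "cdf (distr P borel (X i)) x = p" if "i \<in> ?I" for i
    unfolding X_eq p_def using that assms t2 by (intro cdf_snr_exponential indep_GH) auto
  have prob_X: "prob {\<omega> \<in> space P. X i \<omega> \<in> {..x}} = p" if "i \<in> ?I" for i
  proof -
    have "random_variable borel (X i)" using indep_X that by (simp add: indep_vars_def)
    then show ?thesis
      using cdf_X[OF that] by (simp add: cdf_def measure_distr vimage_def Int_def conj_commute)
  qed
  \<comment> \<open>The bounds hold because \<open>p\<close> is the probability of an event of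
    device 1, which exists since \<open>M\<close> is at least 1.\<close>
  have p01: "0 \<le> p" "p \<le> 1"
    using prob_X[of 1] \<open>M \<ge> 1\<close> by auto

  have "X (istar \<omega>) \<omega> \<le> x \<longleftrightarrow> M - k + 1 \<le> card {i \<in> ?I. X i \<omega> \<in> {..x}}" if "\<omega> \<in> space P" for \<omega>
  proof -
    let ?xs = "filter (\<lambda>i. X i \<omega> \<le> x) [1..<M + 1]"
    have "X (istar \<omega>) \<omega> \<le> x \<longleftrightarrow> M - k < length ?xs"
      using kth_largest_le_iff[of k "map (\<lambda>i. X i \<omega>) [1..<M + 1]" x] assms that
      by (simp add: filter_map comp_def del: upt_Suc)
    \<comment> \<open>The filter runs over the distinct device indices rather than the SNR values,
      so ties are counted separately.\<close>
    also have "length ?xs = card (set ?xs)"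
      by (intro distinct_card[symmetric]) simp
    also have "set ?xs = {i \<in> ?I. X i \<omega> \<in> {..x}}" by auto
    finally show ?thesis by linarith
  qed
  then have "{\<omega> \<in> space P. X (istar \<omega>) \<omega> \<le> x}
      = {\<omega> \<in> space P. M - k + 1 \<le> card {i \<in> ?I. X i \<omega> \<in> {..x}}}" by blast
  then have "outage_prob P (\<lambda>\<omega>. X (istar \<omega>) \<omega>) x = (\<Sum>j=M-k+1..M. Bernstein M j p)"
    using prob_indep_vars_count_ge[OF indep_X _ _ prob_X, of "M - k + 1"] by (simp add: outage_prob_def)
  \<comment> \<open>With \<open>n = M\<close> and \<open>m = M - k + 1\<close>, the second beta
    parameter \<open>n - m + 1\<close> is \<open>k\<close>; \<open>1 \<le> k\<close> ensures
    \<open>m \<le> n\<close>.\<close>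
  also have "\<dots> = norm_incomplete_beta p (real (M - k + 1)) (real M - real (M - k + 1) + 1)"
    using p01 assms by (intro norm_incomplete_beta_eq_Bernstein_tail[symmetric]) auto
  also have "\<dots> = norm_incomplete_beta p (real M - real k + 1) (real k)"
    using \<open>k \<le> M\<close> by (simp add: of_nat_diff add.commute)
  finally show ?thesis using cdf_X by (simp add: p_def)
qed

end
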